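(* Let $(X(q),Y(q),Z(q))$ be a triple of symmetric Laurent polynomials in $q$ with positive integer coefficients satisfying $$X^2+Y^2+Z^2+(q+q^{-1})(XY+YZ+XZ)=3(1+q+q^{-1})XYZ.$$ Then there exist polynomials $x(q),y(q),z(q)$ in $q$ such that $$(X(q),Y(q),Z(q))=\bigl(x(q)x(q^{-1}),\,y(q)y(q^{-1}),\,z(q)z(q^{-1})\bigr)$$ and $(x(1),y(1),z(1))$ is a Markov triple.
   Context: Here $q$ is an indeterminate. A Laurent polynomial $X(q)$ is symmetric if $X(q)=X(q^{-1})$. "With positive integer coefficients" means non-zero, with all non-zero coefficients being positive integers. A Markov triple is a triple $(a,b,c)$ of positive integers with $a^2+b^2+c^2=3abc$. *)

theory Defs
  imports "HOL-Library.Poly_Mapping" "HOL-Computational_Algebra.Polynomial"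
begin

text \<open>
  The ring of Laurent polynomials in \<open>q\<close> over the integers is the group ring of the additive
  group of integers: \<open>lookup X n\<close> is the coefficient of \<open>q\<close> to the power \<open>n\<close>, and the
  multiplication of \<open>\<Rightarrow>\<^sub>0\<close> is convolution.
\<close>
type_synonym laurent = "int \<Rightarrow>\<^sub>0 int"

definition q :: laurent where
  "q = Poly_Mapping.single 1 1"

definition q_inv :: laurent where
  "q_inv = Poly_Mapping.single (- 1) 1"

lemma q_times_q_inv: "q * q_inv = 1"
  by (simp add: q_def q_inv_def mult_single)

text \<open>The substitution \<open>q \<mapsto> 1/q\<close>; \<open>map_key f\<close> is precomposition with \<open>f\<close> for injective \<open>f\<close> only.\<close>
definition subst_q_inv :: "laurent \<Rightarrow> laurent" where
  "subst_q_inv X = Poly_Mapping.map_key uminus X"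

lemma lookup_subst_q_inv: "Poly_Mapping.lookup (subst_q_inv X) n = Poly_Mapping.lookup X (- n)"
  by (simp add: subst_q_inv_def map_key.rep_eq)

definition symmetric :: "laurent \<Rightarrow> bool" where
  "symmetric X \<longleftrightarrow> X = subst_q_inv X"

definition positive_coeffs :: "laurent \<Rightarrow> bool" where
  "positive_coeffs X \<longleftrightarrow> X \<noteq> 0 \<and>
     (\<forall>n. Poly_Mapping.lookup X n \<noteq> 0 \<longrightarrow> Poly_Mapping.lookup X n > 0)"

definition eval_poly :: "int poly \<Rightarrow> laurent \<Rightarrow> laurent" where
  "eval_poly p u = poly (map_poly of_int p) u"

definition markov_triple :: "int \<Rightarrow> int \<Rightarrow> int \<Rightarrow> bool" where
  "markov_triple a b c \<longleftrightarrow>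
     a > 0 \<and> b > 0 \<and> c > 0 \<and> a\<^sup>2 + b\<^sup>2 + c\<^sup>2 = 3 * a * b * c"

end

theory Submission imports Defs begin

text \<open>
  Write \<open>k = q + 1/q\<close>. The equation is quadratic in \<open>X\<close>, and the other root
  \<open>X' = 3 (1 + k) Y Z - k (Y + Z) - X\<close> satisfies
  \<open>X X' = Y\<^sup>2 + k Y Z + Z\<^sup>2 = (Y + q Z) (Y + Z/q)\<close>.
  The two factors on the right are exchanged by \<open>q \<mapsto> 1/q\<close>. Hence if \<open>X\<close> is the product of some
  \<open>x\<close> and its conjugate, and moreover \<open>Y + q Z = x x'\<close>, then \<open>X'\<close> is the product of
  \<open>x'\<close> and its conjugate. This is the analogue of the Vieta jump
  \<open>x x' = y\<^sup>2 + z\<^sup>2\<close> for Markov triples. A solution whose three entries all have such a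
  factor is called linked here (\<open>all_linked\<close>), and Vieta jumps preserve this property
  (\<open>all_linked_vieta\<close>).

  It remains to reach every solution from \<open>(1, 1, 1)\<close>. This is a descent on degrees. Positivity
  of the leading coefficients forbids cancellation, so comparing the degrees \<open>a \<ge> b \<ge> c \<ge> 0\<close>
  of the two sides leaves only two cases (\<open>degree_relation\<close>). If \<open>a = 1 + b + c\<close>, jumping at
  the entry of largest degree lowers it. Otherwise \<open>Z\<close> is constant and \<open>a = b\<close>; then leading
  coefficients force all entries to be constant (\<open>equal_degrees_imp_constant\<close>) and hence equal
  to 1 (\<open>constant_solution\<close>). Symmetry and a positive leading coefficient pass to \<open>X'\<close>, while
  positivity of all its coefficients is not apparent; the descent is therefore carried out for
  these weaker properties (\<open>solution_all_linked\<close>).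

  Finally, at \<open>q = 1\<close> the equation reads \<open>(X + Y + Z)\<^sup>2 = 9 X Y Z\<close>, and there
  \<open>X\<close>, \<open>Y\<close>, \<open>Z\<close> are the squares of \<open>x(1)\<close>, \<open>y(1)\<close>, \<open>z(1)\<close>. Once the signs
  of \<open>x\<close>, \<open>y\<close>, \<open>z\<close> are chosen to make these values positive, taking square roots gives
  the Markov equation.
\<close>

abbreviation coef :: "laurent \<Rightarrow> int \<Rightarrow> int" where
  "coef \<equiv> Poly_Mapping.lookup"

section \<open>Conjugation and evaluation at one as ring homomorphisms\<close>

lemma laurent_induct [case_names zero one diff]:
  fixes A :: laurent
  assumes "P 0" and "\<And>n. P (Poly_Mapping.single n 1)" and "\<And>A B. P A \<Longrightarrow> P B \<Longrightarrow> P (A - B)"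
  shows "P A"
  by (rule frag_induction[of A UNIV]) (use assms in auto)

lemma additive_eqI:
  fixes f g :: "laurent \<Rightarrow> 'a::ab_group_add"
  assumes f: "\<And>A B. f (A - B) = f A - f B" and g: "\<And>A B. g (A - B) = g A - g B"
    and single: "\<And>n. f (Poly_Mapping.single n 1) = g (Poly_Mapping.single n 1)"
  shows "f A = g A"
proof (induction A rule: laurent_induct)
  case zero
  show ?case using f[of 0 0] g[of 0 0] by simp
qed (simp_all add: f g single)

text \<open>
  Both sides are additive in each argument, so the identity only has to be checked on powers of
  \<open>q\<close>. This gives the multiplicativity of conjugation and of evaluation without computing with
  convolutions.
\<close>
lemma multiplicativeI:
  fixes f :: "laurent \<Rightarrow> 'a::comm_ring_1"
  assumes diff: "\<And>A B. f (A - B) = f A - f B"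
    and single: "\<And>m n. f (Poly_Mapping.single (m + n) 1)
                   = f (Poly_Mapping.single m 1) * f (Poly_Mapping.single n 1)"
  shows "f (A * B) = f A * f B"
proof (rule additive_eqI[of "\<lambda>A. f (A * B)" "\<lambda>A. f A * f B"])
  fix m
  show "f (Poly_Mapping.single m 1 * B) = f (Poly_Mapping.single m 1) * f B"
    by (rule additive_eqI[of "\<lambda>B. f (Poly_Mapping.single m 1 * B)"])
      (simp_all add: diff single mult_single algebra_simps)
qed (simp_all add: diff algebra_simps)

lemma subst_q_inv_single [simp]:
  "subst_q_inv (Poly_Mapping.single n c) = Poly_Mapping.single (- n) c"
  by (rule poly_mapping_eqI) (auto simp: lookup_subst_q_inv lookup_single when_def)

lemma subst_q_inv_diff [simp]: "subst_q_inv (A - B) = subst_q_inv A - subst_q_inv B"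
  by (rule poly_mapping_eqI) (simp add: lookup_subst_q_inv lookup_minus)

lemma subst_q_inv_add [simp]: "subst_q_inv (A + B) = subst_q_inv A + subst_q_inv B"
  by (rule poly_mapping_eqI) (simp add: lookup_subst_q_inv lookup_add)

lemma subst_q_inv_mult [simp]: "subst_q_inv (A * B) = subst_q_inv A * subst_q_inv B"
  by (rule multiplicativeI) (simp_all add: mult_single)

lemma of_int_eq_single: "(of_int c :: laurent) = Poly_Mapping.single 0 c"
  by (metis id_apply of_int_eq_id single_of_int)

lemma subst_q_inv_subst_q_inv [simp]: "subst_q_inv (subst_q_inv A) = A"
  by (rule poly_mapping_eqI) (simp add: lookup_subst_q_inv)

lemma subst_q_inv_of_int [simp]: "subst_q_inv (of_int c) = of_int c"
  by (simp add: of_int_eq_single)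

lemma subst_q_inv_numeral [simp]: "subst_q_inv (numeral c) = numeral c"
  using subst_q_inv_of_int[of "numeral c"] by simp

lemma subst_q_inv_1 [simp]: "subst_q_inv 1 = 1"
  using subst_q_inv_of_int[of 1] by simp

lemma subst_q_inv_0 [simp]: "subst_q_inv 0 = 0"
  using subst_q_inv_of_int[of 0] by simp

lemma subst_q_inv_q [simp]: "subst_q_inv q = q_inv" "subst_q_inv q_inv = q"
  by (simp_all add: q_def q_inv_def)

lemma subst_q_inv_power [simp]: "subst_q_inv (A ^ n) = subst_q_inv A ^ n"
  by (induction n) simp_all

definition eval_one :: "laurent \<Rightarrow> int" where
  "eval_one A = (\<Sum>n\<in>Poly_Mapping.keys A. coef A n)"

lemma eval_one_superset:
  assumes "finite S" "Poly_Mapping.keys A \<subseteq> S"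
  shows "eval_one A = (\<Sum>n\<in>S. coef A n)"
  unfolding eval_one_def using assms
  by (intro sum.mono_neutral_left) (auto simp: in_keys_iff)

lemma eval_one_single [simp]: "eval_one (Poly_Mapping.single n c) = c"
  by (simp add: eval_one_def)

lemma eval_one_diff [simp]: "eval_one (A - B) = eval_one A - eval_one B"
proof -
  let ?S = "Poly_Mapping.keys A \<union> Poly_Mapping.keys B"
  have "Poly_Mapping.keys (A - B) \<subseteq> ?S"
    by (auto simp: in_keys_iff lookup_minus)
  then show ?thesis
    by (simp add: eval_one_superset[of ?S] lookup_minus sum_subtractf)
qed

lemma eval_one_of_int [simp]: "eval_one (of_int c) = c"
  by (simp add: of_int_eq_single)

lemma eval_one_const [simp]: "eval_one 0 = 0" "eval_one 1 = 1" "eval_one (numeral w) = numeral w"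
  using eval_one_of_int[of 0] eval_one_of_int[of 1] eval_one_of_int[of "numeral w"] by simp_all

lemma eval_one_uminus [simp]: "eval_one (- A) = - eval_one A"
  using eval_one_diff[of 0 A] by simp

lemma eval_one_add [simp]: "eval_one (A + B) = eval_one A + eval_one B"
  using eval_one_diff[of A "- B"] by simp

lemma eval_one_mult [simp]: "eval_one (A * B) = eval_one A * eval_one B"
  by (rule multiplicativeI) simp_all

lemma eval_one_power [simp]: "eval_one (A ^ n) = eval_one A ^ n"
  by (induction n) simp_all

lemma eval_one_q [simp]: "eval_one q = 1" "eval_one q_inv = 1"
  by (simp_all add: q_def q_inv_def)

lemma eval_one_subst_q_inv [simp]: "eval_one (subst_q_inv A) = eval_one A"
  by (rule additive_eqI) simp_all

lemma eval_one_pos: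
  assumes "positive_coeffs A"
  shows "eval_one A > 0"
  unfolding eval_one_def using assms
  by (intro sum_pos) (auto simp: positive_coeffs_def in_keys_iff)

section \<open>Laurent polynomials and ordinary polynomials\<close>

lemma eval_poly_pCons [simp]: "eval_poly (pCons c p) u = of_int c + u * eval_poly p u"
  by (cases "c = 0 \<and> p = 0") (auto simp: eval_poly_def map_poly_pCons)

lemma eval_poly_0 [simp]: "eval_poly 0 u = 0"
  by (simp add: eval_poly_def)

lemma eval_poly_1 [simp]: "eval_poly 1 u = 1"
  by (simp add: eval_poly_def)

lemma subst_q_inv_eval_poly: "subst_q_inv (eval_poly p q) = eval_poly p q_inv"
  by (induction p) simp_all

lemma eval_one_eval_poly: "eval_one (eval_poly p q) = poly p 1"
  by (induction p) simp_all

lemma eval_poly_diff: "eval_poly (p - r) u = eval_poly p u - eval_poly r u"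
proof (induction p r rule: poly_induct2)
  case (pCons a p b r)
  then show ?case by (simp add: right_diff_distrib)
qed simp

lemma eval_poly_shift: "eval_poly (monom 1 n * p) u = u ^ n * eval_poly p u"
  by (induction n) (simp_all add: monom_0 monom_Suc algebra_simps one_pCons[symmetric])

lemma q_power: "q ^ n = Poly_Mapping.single (int n) 1"
  by (induction n) (simp_all add: q_def mult_single)

lemma eval_poly_monom: "eval_poly (monom 1 n) q = q ^ n"
  using eval_poly_shift[of n 1 q] by (simp add: one_pCons)

lemma q_power_times_is_poly: "\<exists>n p. q ^ n * A = eval_poly p q"
proof (induction A rule: laurent_induct)
  case zero
  show ?case by (metis eval_poly_0 mult_zero_right)
next
  case (one m)
  show ?case
  proof (cases "m \<ge> 0")
    case True
    then have "q ^ 0 * Poly_Mapping.single m 1 = eval_poly (monom 1 (nat m)) q"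
      by (simp add: eval_poly_monom q_power)
    then show ?thesis by blast
  next
    case False
    then have "q ^ nat (- m) * Poly_Mapping.single m 1 = eval_poly (monom 1 0) q"
      by (simp add: eval_poly_monom q_power mult_single)
    then show ?thesis by blast
  qed
next
  case (diff A B)
  then obtain m n p r where *: "q ^ m * A = eval_poly p q" "q ^ n * B = eval_poly r q"
    by blast
  have "q ^ (m + n) * (A - B) = q ^ n * (q ^ m * A) - q ^ m * (q ^ n * B)"
    by (simp add: power_add algebra_simps)
  also have "\<dots> = eval_poly (monom 1 n * p - monom 1 m * r) q"
    by (simp add: * eval_poly_diff eval_poly_shift)
  finally have "q ^ (m + n) * (A - B) = eval_poly (monom 1 n * p - monom 1 m * r) q" .
  then show ?case by blast
qed

lemma q_power_cancel: "q ^ n * q_inv ^ n = 1"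
  by (simp add: q_times_q_inv flip: power_mult_distrib)

text \<open>
  Multiplying \<open>x\<close> by a power of \<open>q\<close>, whose conjugate is its inverse, or by \<open>-1\<close> does not change
  \<open>x * subst_q_inv x\<close>. The former makes \<open>x\<close> a polynomial, the latter fixes the sign of its value
  at 1.
\<close>
lemma norm_square_as_poly:
  assumes X: "X = x * subst_q_inv x"
  obtains p where "X = eval_poly p q * eval_poly p q_inv" "poly p 1 \<ge> 0"
proof -
  obtain n r where r: "q ^ n * x = eval_poly r q"
    using q_power_times_is_poly by blast
  have "eval_poly r q * eval_poly r q_inv = (q ^ n * x) * subst_q_inv (q ^ n * x)"
    by (simp add: r subst_q_inv_eval_poly)
  also have "\<dots> = (q ^ n * q_inv ^ n) * X"
    by (simp add: X mult_ac)
  finally have *: "X = eval_poly r q * eval_poly r q_inv"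
    by (simp add: q_power_cancel)
  show thesis
  proof (cases "poly r 1 \<ge> 0")
    case True
    then show thesis using that * by blast
  next
    case False
    then show thesis using that[of "- r"] * eval_poly_diff[of 0 r] by simp
  qed
qed

section \<open>Leading terms\<close>

text \<open>
  A relation rather than a degree function: sums and products of elements with positive leading
  coefficients are then handled by introduction rules that compute the degree.
\<close>
definition pos_lead :: "laurent \<Rightarrow> int \<Rightarrow> bool" where
  "pos_lead A n \<longleftrightarrow> coef A n > 0 \<and> (\<forall>m>n. coef A m = 0)"

lemma pos_lead_le:
  assumes "pos_lead A n" "coef A m \<noteq> 0"
  shows "m \<le> n"
  using assms by (force simp: pos_lead_def)

lemma pos_lead_unique:
  assumes "pos_lead A m" "pos_lead A n"
  shows "m = n"
  using assms pos_lead_le[of A m n] pos_lead_le[of A n m] by (simp add: pos_lead_def)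

lemma pos_lead_uminus:
  assumes "pos_lead A m"
  shows "\<not> pos_lead (- A) n"
proof
  assume "pos_lead (- A) n"
  with assms have "m = n"
    using pos_lead_le[of A m n] pos_lead_le[of "- A" n m] by (simp add: pos_lead_def)
  with assms \<open>pos_lead (- A) n\<close> show False by (simp add: pos_lead_def)
qed

lemma pos_lead_add:
  assumes "pos_lead A m" "pos_lead B n"
  shows "pos_lead (A + B) (max m n)"
  using assms by (cases m n rule: linorder_cases) (auto simp: pos_lead_def lookup_add)

lemma coef_mult_above:
  assumes A: "\<forall>i>m. coef A i = 0" and B: "\<forall>j\<ge>n. coef B j = 0" and k: "k \<ge> m + n"
  shows "coef (A * B) k = 0"
proof (rule ccontr)
  assume "coef (A * B) k \<noteq> 0"
  then have "k \<in> Poly_Mapping.keys (A * B)" by (simp add: in_keys_iff)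
  then obtain i j where "k = i + j" "coef A i \<noteq> 0" "coef B j \<noteq> 0"
    using keys_mult[of A B] by (auto simp: in_keys_iff)
  with A B k show False by (smt (verit))
qed

lemma pos_lead_mult:
  assumes A: "pos_lead A m" and B: "pos_lead B n"
  shows "pos_lead (A * B) (m + n)"
proof -
  define S where "S = Poly_Mapping.single m (coef A m)"
  define T where "T = Poly_Mapping.single n (coef B n)"
  have tails: "\<forall>i\<ge>m. coef (A - S) i = 0" "\<forall>j\<ge>n. coef (B - T) j = 0"
    using A B by (auto simp: pos_lead_def S_def T_def lookup_minus lookup_single when_def)
  have S: "\<forall>i>m. coef S i = 0"
    by (auto simp: S_def lookup_single when_def)
  have "A * B = S * T + (S * (B - T) + B * (A - S))"
    by (simp add: algebra_simps)
  moreover have "coef (S * (B - T)) k = 0" if "k \<ge> m + n" for k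
    using coef_mult_above[OF S tails(2)] that by simp
  moreover have "coef (B * (A - S)) k = 0" if "k \<ge> m + n" for k
    using coef_mult_above[of n B m "A - S" k] B tails(1) that by (simp add: pos_lead_def)
  ultimately have "coef (A * B) k = coef (S * T) k" if "k \<ge> m + n" for k
    using that by (simp add: lookup_add)
  moreover have "S * T = Poly_Mapping.single (m + n) (coef A m * coef B n)"
    by (simp add: S_def T_def mult_single)
  ultimately show ?thesis
    using A B by (auto simp: pos_lead_def lookup_single when_def)
qed

lemma pos_lead_cases:
  assumes "A \<noteq> 0"
  obtains n where "pos_lead A n \<or> pos_lead (- A) n"
proof -
  let ?K = "Poly_Mapping.keys A"
  have "Max ?K \<in> ?K" "\<forall>m>Max ?K. m \<notin> ?K"
    using assms by (auto simp: leD)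
  then have "pos_lead A (Max ?K) \<or> pos_lead (- A) (Max ?K)"
    by (auto simp: pos_lead_def in_keys_iff)
  then show thesis by (rule that)
qed

text \<open>
  This is what passes positivity to the other root of the quadratic: the product of the two roots
  is a sum of terms with positive leading coefficients, and leading coefficients multiply.
\<close>
lemma pos_lead_cofactor:
  assumes A: "pos_lead A m" and AB: "pos_lead (A * B) n"
  shows "pos_lead B (n - m)"
proof -
  have "B \<noteq> 0" using AB by (auto simp: pos_lead_def)
  then obtain k where "pos_lead B k \<or> pos_lead (- B) k"
    by (rule pos_lead_cases)
  then show ?thesis
  proof
    assume "pos_lead B k"
    then show ?thesis using pos_lead_unique[OF AB pos_lead_mult[OF A]] by force
  next
    assume "pos_lead (- B) k"
    then show ?thesis using pos_lead_mult[OF A] pos_lead_uminus[OF AB] by force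
  qed
qed

lemma positive_coeffs_pos_lead:
  assumes "positive_coeffs A"
  obtains n where "pos_lead A n"
proof -
  obtain n where n: "pos_lead A n \<or> pos_lead (- A) n"
    using assms pos_lead_cases by (auto simp: positive_coeffs_def)
  then have "coef A n \<noteq> 0" by (auto simp: pos_lead_def)
  with assms have "coef A n > 0" by (simp add: positive_coeffs_def)
  with n have "pos_lead A n" by (auto simp: pos_lead_def)
  then show thesis by (rule that)
qed

lemma pos_lead_of_int: "pos_lead (of_int c) 0 \<longleftrightarrow> c > 0"
  by (auto simp: pos_lead_def lookup_of_int when_def)

lemma symmetric_pos_lead_nonneg:
  assumes "symmetric A" "pos_lead A n"
  shows "n \<ge> 0"
proof -
  have "coef A (- n) = coef A n"
    using assms(1) by (metis lookup_subst_q_inv symmetric_def)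
  then show ?thesis using pos_lead_le[OF assms(2), of "- n"] assms(2) by (simp add: pos_lead_def)
qed

lemma symmetric_pos_lead_0:
  assumes "symmetric A" "pos_lead A 0"
  shows "A = of_int (coef A 0)"
proof (rule poly_mapping_eqI)
  fix k
  have "coef A (- k) = coef A k"
    using assms(1) by (metis lookup_subst_q_inv symmetric_def)
  then show "coef A k = coef (of_int (coef A 0)) k"
    using assms(2) by (cases k "0 :: int" rule: linorder_cases)
      (auto simp: pos_lead_def lookup_of_int when_def)
qed

section \<open>The equation and its Vieta involution\<close>

definition solution :: "laurent \<Rightarrow> laurent \<Rightarrow> laurent \<Rightarrow> bool" where
  "solution X Y Z \<longleftrightarrow>
     X\<^sup>2 + Y\<^sup>2 + Z\<^sup>2 + (q + q_inv) * (X * Y + Y * Z + X * Z) = 3 * (1 + q + q_inv) * X * Y * Z"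

definition vieta :: "laurent \<Rightarrow> laurent \<Rightarrow> laurent \<Rightarrow> laurent" where
  "vieta X Y Z = 3 * (1 + q + q_inv) * Y * Z - (q + q_inv) * (Y + Z) - X"

lemma vieta_vieta [simp]: "vieta (vieta X Y Z) Y Z = X"
  by (simp add: vieta_def)

lemma solution_vieta: "solution X Y Z \<Longrightarrow> solution (vieta X Y Z) Y Z"
  unfolding solution_def vieta_def by algebra

lemma vieta_product:
  assumes "solution X Y Z"
  shows "X * vieta X Y Z = (Y + q * Z) * (Y + q_inv * Z)"
  using assms q_times_q_inv unfolding solution_def vieta_def by algebra

lemma symmetric_vieta:
  assumes "symmetric X" "symmetric Y" "symmetric Z"
  shows "symmetric (vieta X Y Z)"
  using assms unfolding symmetric_def vieta_def by (simp add: algebra_simps)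

text \<open>
  Conjugating the divisibility shows that replacing \<open>x\<close> by its conjugate replaces \<open>q\<close> by
  \<open>q_inv\<close>, so neither the choice between them nor the order of \<open>Y\<close> and \<open>Z\<close> matters for
  symmetric \<open>Y\<close> and \<open>Z\<close>; see \<open>linked_conj\<close> and \<open>linked_swap\<close>.
\<close>
definition linked :: "laurent \<Rightarrow> laurent \<Rightarrow> laurent \<Rightarrow> bool" where
  "linked X Y Z \<longleftrightarrow> (\<exists>x. X = x * subst_q_inv x \<and> x dvd Y + q * Z)"

lemma subst_q_inv_dvd:
  assumes "A dvd B"
  shows "subst_q_inv A dvd subst_q_inv B"
  using assms by (auto simp: dvd_def)

lemma linked_conj:
  assumes "linked X Y Z" "symmetric Y" "symmetric Z"
  obtains x where "X = x * subst_q_inv x" "x dvd Y + q_inv * Z"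
proof -
  obtain x where x: "X = x * subst_q_inv x" "x dvd Y + q * Z"
    using assms(1) by (auto simp: linked_def)
  from subst_q_inv_dvd[OF x(2)] have "subst_q_inv x dvd Y + q_inv * Z"
    using assms(2,3) by (simp add: symmetric_def)
  with x(1) show thesis using that[of "subst_q_inv x"] by (simp add: mult.commute)
qed

lemma linked_swap:
  assumes "linked X Y Z" "symmetric Y" "symmetric Z"
  shows "linked X Z Y"
proof -
  obtain x where x: "X = x * subst_q_inv x" "x dvd Y + q_inv * Z"
    using linked_conj[OF assms] .
  have "Z + q * Y = q * (Y + q_inv * Z)"
    using q_times_q_inv by algebra
  with x show ?thesis by (auto simp: linked_def)
qed

text \<open>
  Splitting \<open>X * vieta X Y Z\<close> into the conjugate factors \<open>Y + q * Z\<close> and \<open>Y + q_inv * Z\<close>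
  and cancelling \<open>X\<close> shows that the cofactor of \<open>x\<close> in \<open>Y + q * Z\<close> is a factor for the new
  entry; by construction it divides the same element.
\<close>
lemma linked_vieta_self:
  assumes "solution X Y Z" "symmetric Y" "symmetric Z" "X \<noteq> 0" "linked X Y Z"
  shows "linked (vieta X Y Z) Y Z"
proof -
  obtain x x' where x: "X = x * subst_q_inv x" and x': "Y + q * Z = x * x'"
    using assms(5) by (auto simp: linked_def dvd_def)
  have "Y + q_inv * Z = subst_q_inv (Y + q * Z)"
    using assms(2,3) by (simp add: symmetric_def)
  then have "X * vieta X Y Z = x * x' * subst_q_inv (x * x')"
    using vieta_product[OF assms(1)] by (simp add: x')
  also have "\<dots> = X * (x' * subst_q_inv x')"
    by (simp add: x mult_ac)
  finally have "vieta X Y Z = x' * subst_q_inv x'"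
    using assms(4) by simp
  then show ?thesis by (auto simp: linked_def x')
qed

text \<open>
  Modulo \<open>Y\<close> the new entry is \<open>- (q + q_inv) * Z - X\<close>. If \<open>y\<close> divides \<open>Y\<close> and
  \<open>X \<equiv> - q * Z\<close> modulo \<open>y\<close>, the new entry is therefore \<open>- q_inv * Z\<close>: the jump exchanges
  the roles of \<open>q\<close> and \<open>q_inv\<close>, and the witness is the conjugate of the old one.
\<close>
lemma linked_vieta_other:
  assumes "symmetric X" "symmetric Y" "symmetric Z" "linked Y Z X"
  shows "linked Y Z (vieta X Y Z)"
proof -
  obtain y where y: "Y = y * subst_q_inv y" "y dvd Z + q_inv * X"
    using linked_conj[OF assms(4,3,1)] .
  have "Z + q * vieta X Y Z
      = Y * (q * (3 * (1 + q + q_inv) * Z - (q + q_inv))) - q\<^sup>2 * (Z + q_inv * X)"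
    using q_times_q_inv unfolding vieta_def by algebra
  moreover have "y dvd Y" using y(1) by simp
  ultimately have "y dvd Z + q * vieta X Y Z"
    using y(2) by (metis dvd_diff dvd_mult dvd_mult2)
  with y(1) show ?thesis by (auto simp: linked_def)
qed

section \<open>Descent on the degrees\<close>

lemma vieta_commute: "vieta X Y Z = vieta X Z Y"
  by (simp add: vieta_def algebra_simps)

definition all_linked :: "laurent \<Rightarrow> laurent \<Rightarrow> laurent \<Rightarrow> bool" where
  "all_linked X Y Z \<longleftrightarrow> linked X Y Z \<and> linked Y Z X \<and> linked Z X Y"

lemma all_linked_vieta:
  assumes "solution X Y Z" "symmetric X" "symmetric Y" "symmetric Z" "X \<noteq> 0" "all_linked X Y Z"
  shows "all_linked (vieta X Y Z) Y Z"
proof -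
  have "symmetric (vieta X Y Z)" using assms symmetric_vieta by blast
  moreover have "linked Z Y X"
    using assms linked_swap unfolding all_linked_def by blast
  then have "linked Z Y (vieta X Y Z)"
    using linked_vieta_other[of X Z Y] assms by (simp add: vieta_commute[of X Y])
  ultimately show ?thesis
    using assms linked_vieta_self linked_vieta_other linked_swap unfolding all_linked_def by metis
qed

lemma pos_lead_q_plus_q_inv: "pos_lead (q + q_inv) 1"
  by (auto simp: pos_lead_def q_def q_inv_def lookup_single when_def lookup_add)

lemma pos_lead_const_plus_q:
  assumes "c > 0"
  shows "pos_lead (of_int b + of_int c * (q + q_inv)) 1"
proof -
  have "of_int c * (q + q_inv) = Poly_Mapping.single 1 c + Poly_Mapping.single (- 1) c"
    by (simp add: q_def q_inv_def mult_single algebra_simps of_int_eq_single)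
  then show ?thesis using assms
    by (auto simp: pos_lead_def lookup_single when_def lookup_add lookup_of_int)
qed

text \<open>
  The right-hand side has degree \<open>1 + a + b + c\<close> and the left-hand side has degree
  \<open>max (2 * a) (1 + a + b)\<close>.
\<close>
lemma degree_relation:
  assumes "solution X Y Z" "pos_lead X a" "pos_lead Y b" "pos_lead Z c"
    and "a \<ge> b" "b \<ge> c" "c \<ge> 0"
  shows "a = 1 + b + c \<or> c = 0 \<and> a \<le> b"
proof -
  note intros = pos_lead_add pos_lead_mult pos_lead_q_plus_q_inv assms
  have "pos_lead (X * X + Y * Y + Z * Z + (q + q_inv) * (X * Y + Y * Z + X * Z))
     (max (max (max (a + a) (b + b)) (c + c)) (1 + max (max (a + b) (b + c)) (a + c)))"
    by (intro intros)
  moreover have "pos_lead (of_int 3 + of_int 3 * (q + q_inv)) 1"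
    by (rule pos_lead_const_plus_q) simp
  then have "pos_lead ((of_int 3 + of_int 3 * (q + q_inv)) * X * Y * Z) (1 + a + b + c)"
    by (intro intros)
  moreover have "(of_int 3 + of_int 3 * (q + q_inv)) * X * Y * Z
      = X * X + Y * Y + Z * Z + (q + q_inv) * (X * Y + Y * Z + X * Z)"
    using assms(1) unfolding solution_def by (simp add: power2_eq_square algebra_simps)
  ultimately have
    "1 + a + b + c = max (max (max (a + a) (b + b)) (c + c)) (1 + max (max (a + b) (b + c)) (a + c))"
    using pos_lead_unique by metis
  with assms(5-7) show ?thesis by linarith
qed

text \<open>
  With \<open>Z\<close> constant, the term \<open>(q + q_inv) * X * Y\<close> has the same degree as the right-hand side.
  Moving it there leaves the coefficient \<open>3 * z - 1 > 0\<close>, so the right-hand side still has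
  degree \<open>1 + 2 * a\<close>, which exceeds that of the remaining terms unless \<open>a = 0\<close>.
\<close>
lemma equal_degrees_imp_constant:
  assumes "solution X Y Z" "pos_lead X a" "pos_lead Y a" "Z = of_int z" "z > 0" "a \<ge> 0"
  shows "a = 0"
proof -
  have k: "pos_lead (of_int (3 * z) + of_int (3 * z - 1) * (q + q_inv)) 1"
    using assms(5) by (intro pos_lead_const_plus_q) simp
  have Z: "pos_lead Z 0"
    using assms(4,5) by (simp add: pos_lead_of_int)
  note intros = pos_lead_add pos_lead_mult pos_lead_q_plus_q_inv assms k Z
  have "pos_lead (X * X + Y * Y + Z * Z + (q + q_inv) * Z * (X + Y))
      (max (max (max (a + a) (a + a)) (0 + 0)) (1 + 0 + max a a))"
    by (intro intros)
  moreover have "pos_lead ((of_int (3 * z) + of_int (3 * z - 1) * (q + q_inv)) * X * Y) (1 + a + a)"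
    by (intro intros)
  moreover have "(of_int (3 * z) + of_int (3 * z - 1) * (q + q_inv)) * X * Y
      = X * X + Y * Y + Z * Z + (q + q_inv) * Z * (X + Y)"
    using assms(1) unfolding solution_def assms(4)
    by (simp add: power2_eq_square algebra_simps)
  ultimately have "1 + a + a = max (max (max (a + a) (a + a)) (0 + 0)) (1 + 0 + max a a)"
    using pos_lead_unique by metis
  with assms(6) show ?thesis by linarith
qed

text \<open>
  For constants, the coefficients of \<open>1\<close> and of \<open>q + q_inv\<close> can be compared separately. They give
  \<open>x\<^sup>2 + y\<^sup>2 + z\<^sup>2 = x * y + y * z + x * z\<close>, which forces \<open>x = y = z\<close>.
\<close>
lemma constant_solution:
  assumes sol: "solution (of_int x) (of_int y) (of_int z)" and pos: "x > 0" "y > 0" "z > 0"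
  shows "x = 1 \<and> y = 1 \<and> z = 1"
proof -
  define s t where "s = x\<^sup>2 + y\<^sup>2 + z\<^sup>2 - 3 * x * y * z"
    and "t = x * y + y * z + x * z - 3 * x * y * z"
  have "of_int s + of_int t * (q + q_inv) = 0"
    using sol unfolding solution_def s_def t_def by (simp add: algebra_simps)
  then have "coef (of_int s + (Poly_Mapping.single 1 t + Poly_Mapping.single (- 1) t)) n = 0" for n
    by (simp add: q_def q_inv_def mult_single algebra_simps of_int_eq_single)
  from this[of 0] this[of 1] have "s = 0" "t = 0"
    by (auto simp: lookup_add lookup_of_int lookup_single)
  then have "(x - y)\<^sup>2 + (y - z)\<^sup>2 + (x - z)\<^sup>2 = 0"
    unfolding s_def t_def by algebra
  then have eq: "y = x" "z = x"
    using zero_le_power2[of "x - y"] zero_le_power2[of "y - z"] zero_le_power2[of "x - z"]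
    by (smt (verit) zero_eq_power2)+
  with \<open>s = 0\<close> have "3 * x\<^sup>2 * (1 - x) = 0"
    unfolding s_def by algebra
  with eq pos show ?thesis by simp
qed

lemma vieta_degree:
  assumes "solution X Y Z" "pos_lead X a" "pos_lead Y b" "pos_lead Z c"
  shows "pos_lead (vieta X Y Z) (max (max (b + b) (c + c)) (1 + b + c) - a)"
proof -
  note intros = pos_lead_add pos_lead_mult pos_lead_q_plus_q_inv assms
  have "pos_lead (Y * Y + Z * Z + (q + q_inv) * Y * Z) (max (max (b + b) (c + c)) (1 + b + c))"
    by (intro intros)
  moreover have "X * vieta X Y Z = Y * Y + Z * Z + (q + q_inv) * Y * Z"
    using vieta_product[OF assms(1)] q_times_q_inv by algebra
  ultimately show ?thesis
    using pos_lead_cofactor[OF assms(2)] by metis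
qed

lemma all_linked_1: "all_linked 1 1 1"
  by (auto simp: all_linked_def linked_def intro!: exI[of _ 1])

text \<open>
  Induction on the sum of the degrees. A solution with \<open>a = 1 + b + c\<close> is the jump of a smaller
  one, because the jump is an involution, and jumping preserves the linked property. The equation
  and the property are both invariant under permutations, so the degrees may be taken in
  decreasing order.
\<close>
lemma solution_all_linked:
  assumes "solution X Y Z" "symmetric X" "symmetric Y" "symmetric Z"
    and "pos_lead X a" "pos_lead Y b" "pos_lead Z c"
  shows "all_linked X Y Z"
  using assms
proof (induction "nat (a + b + c)" arbitrary: X Y Z a b c rule: less_induct)
  case less
  have ordered: "all_linked X' Y' Z'"
    if sol: "solution X' Y' Z'" and sym: "symmetric X'" "symmetric Y'" "symmetric Z'"
      and lead: "pos_lead X' a'" "pos_lead Y' b'" "pos_lead Z' c'"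
      and ord: "a' \<ge> b'" "b' \<ge> c'" and sum: "a' + b' + c' = a + b + c"
    for X' Y' Z' a' b' c'
  proof -
    have "c' \<ge> 0" using symmetric_pos_lead_nonneg[OF sym(3) lead(3)] .
    from degree_relation[OF sol lead ord this] show ?thesis
    proof
      assume a': "a' = 1 + b' + c'"
      let ?W = "vieta X' Y' Z'"
      define d where "d = max (max (b' + b') (c' + c')) (1 + b' + c') - a'"
      have W: "pos_lead ?W d" "symmetric ?W" "solution ?W Y' Z'"
        using vieta_degree[OF sol lead] symmetric_vieta[OF sym] solution_vieta[OF sol]
        by (simp_all add: d_def)
      have "d < a'" using a' ord \<open>c' \<ge> 0\<close> unfolding d_def by linarith
      then have "nat (d + b' + c') < nat (a + b + c)"
        using ord a' \<open>c' \<ge> 0\<close> sum by linarith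
      then have "all_linked ?W Y' Z'"
        using less.hyps W sym lead by blast
      \<comment> \<open>Jump back from the smaller solution to the given one.\<close>
      moreover have "?W \<noteq> 0" using W(1) by (auto simp: pos_lead_def)
      ultimately have "all_linked (vieta ?W Y' Z') Y' Z'"
        using all_linked_vieta W sym by blast
      then show ?thesis by simp
    next
      assume "c' = 0 \<and> a' \<le> b'"
      with ord lead have lead': "pos_lead Y' a'" "pos_lead Z' 0" and "a' \<ge> 0" by auto
      obtain z where z: "Z' = of_int z" "z > 0"
        using symmetric_pos_lead_0[OF sym(3) lead'(2)] lead'(2) by (auto simp: pos_lead_def)
      have "a' = 0"
        using equal_degrees_imp_constant[OF sol lead(1) lead'(1) z \<open>a' \<ge> 0\<close>] .
      then obtain x y where "X' = of_int x" "x > 0" "Y' = of_int y" "y > 0"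
        using symmetric_pos_lead_0 sym lead(1) lead'(1) unfolding pos_lead_def by metis
      with constant_solution[of x y z] sol z show ?thesis
        by (simp add: all_linked_1)
    qed
  qed
  consider "a \<ge> b" "b \<ge> c" | "a \<ge> c" "c \<ge> b" | "b \<ge> a" "a \<ge> c"
    | "b \<ge> c" "c \<ge> a" | "c \<ge> a" "a \<ge> b" | "c \<ge> b" "b \<ge> a" by linarith
  then show ?case
  proof cases
    case 1
    then show ?thesis using ordered less.prems by blast
  next
    case 2
    have "solution X Z Y"
      using less.prems(1) by (simp add: solution_def algebra_simps)
    then have "all_linked X Z Y"
      by (rule ordered[of _ _ _ a c b]) (simp_all add: less.prems 2)
    then show ?thesis using less.prems(2-4) by (simp add: all_linked_def linked_swap)
  next
    case 3
    have "solution Y X Z"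
      using less.prems(1) by (simp add: solution_def algebra_simps)
    then have "all_linked Y X Z"
      by (rule ordered[of _ _ _ b a c]) (simp_all add: less.prems 3)
    then show ?thesis using less.prems(2-4) by (simp add: all_linked_def linked_swap)
  next
    case 4
    have "solution Y Z X"
      using less.prems(1) by (simp add: solution_def algebra_simps)
    then have "all_linked Y Z X"
      by (rule ordered[of _ _ _ b c a]) (simp_all add: less.prems 4)
    then show ?thesis by (simp add: all_linked_def)
  next
    case 5
    have "solution Z X Y"
      using less.prems(1) by (simp add: solution_def algebra_simps)
    then have "all_linked Z X Y"
      by (rule ordered[of _ _ _ c a b]) (simp_all add: less.prems 5)
    then show ?thesis by (simp add: all_linked_def)
  next
    case 6
    have "solution Z Y X"
      using less.prems(1) by (simp add: solution_def algebra_simps)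
    then have "all_linked Z Y X"
      by (rule ordered[of _ _ _ c b a]) (simp_all add: less.prems 6)
    then show ?thesis using less.prems(2-4) by (simp add: all_linked_def linked_swap)
  qed
qed

section \<open>Specialization at one\<close>

lemma markov_from_squares:
  fixes a b c :: int
  assumes "a > 0" "b > 0" "c > 0" and "(a\<^sup>2 + b\<^sup>2 + c\<^sup>2)\<^sup>2 = (3 * a * b * c)\<^sup>2"
  shows "markov_triple a b c"
  using assms power2_eq_iff_nonneg[of "a\<^sup>2 + b\<^sup>2 + c\<^sup>2" "3 * a * b * c"]
  by (simp add: markov_triple_def)

theorem mainTheorem3:
  fixes X Y Z :: laurent
  assumes "symmetric X" and "symmetric Y" and "symmetric Z"
    and "positive_coeffs X" and "positive_coeffs Y" and "positive_coeffs Z"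
    and "X\<^sup>2 + Y\<^sup>2 + Z\<^sup>2 + (q + q_inv) * (X * Y + Y * Z + X * Z)
           = 3 * (1 + q + q_inv) * X * Y * Z"
  shows "\<exists>x y z :: int poly.
           X = eval_poly x q * eval_poly x q_inv \<and>
           Y = eval_poly y q * eval_poly y q_inv \<and>
           Z = eval_poly z q * eval_poly z q_inv \<and>
           markov_triple (poly x 1) (poly y 1) (poly z 1)"
proof -
  obtain a b c where "pos_lead X a" "pos_lead Y b" "pos_lead Z c"
    using positive_coeffs_pos_lead assms(4-6) by metis
  then have "all_linked X Y Z"
    using solution_all_linked assms by (simp add: solution_def)
  then obtain x y z where
    x: "X = eval_poly x q * eval_poly x q_inv" "poly x 1 \<ge> 0" and
    y: "Y = eval_poly y q * eval_poly y q_inv" "poly y 1 \<ge> 0" and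
    z: "Z = eval_poly z q * eval_poly z q_inv" "poly z 1 \<ge> 0"
    using norm_square_as_poly unfolding all_linked_def linked_def by metis
  have eval: "eval_one (eval_poly p q * eval_poly p q_inv) = (poly p 1)\<^sup>2" for p
    by (simp add: eval_one_eval_poly power2_eq_square flip: subst_q_inv_eval_poly)
  have one: "eval_one X = (poly x 1)\<^sup>2" "eval_one Y = (poly y 1)\<^sup>2" "eval_one Z = (poly z 1)\<^sup>2"
    using x(1) y(1) z(1) eval by metis+
  have pos: "poly x 1 > 0" "poly y 1 > 0" "poly z 1 > 0"
    using eval_one_pos[OF assms(4)] eval_one_pos[OF assms(5)] eval_one_pos[OF assms(6)] x(2) y(2) z(2)
    unfolding one by (simp_all add: order.order_iff_strict)
  have "eval_one X ^ 2 + eval_one Y ^ 2 + eval_one Z ^ 2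
      + 2 * (eval_one X * eval_one Y + eval_one Y * eval_one Z + eval_one X * eval_one Z)
      = 9 * eval_one X * eval_one Y * eval_one Z"
    using arg_cong[OF assms(7), of eval_one] by simp
  then have "((poly x 1)\<^sup>2 + (poly y 1)\<^sup>2 + (poly z 1)\<^sup>2)\<^sup>2 = (3 * poly x 1 * poly y 1 * poly z 1)\<^sup>2"
    unfolding one by algebra
  with pos have "markov_triple (poly x 1) (poly y 1) (poly z 1)"
    by (rule markov_from_squares)
  with x y z show ?thesis by blast
qed

end
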